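(* Let $\Omega^\circ\subset\mathbb R^d$ be the (nonempty) interior of $\Omega$, let $0<r_{\min}<r_{\max}<\infty$ and let $\varepsilon>0$ be sufficiently small (so that $r_{\min}-\varepsilon>0$). Let $\nabla^{\mathfrak C}$ be the Levi-Civita connection of $\mathfrak C_{\Omega^\circ}=\Omega^\circ\times(r_{\min}-\varepsilon,r_{\max}+\varepsilon)$ with the cone metric. Let $X(x)=\sum_{i=1}^dX^i(x)\partial_{x_i}$ and $Y(x)=\sum_{i=1}^dY^i(x)\partial_{x_i}$ be (lifts to $\mathfrak C_{\Omega^\circ}$ of) smooth vector fields on $\Omega^\circ$ and let $V=v(r)\partial_r$, $W=w(r)\partial_r$ be (lifts of) smooth vector fields on $(r_{\min}-\varepsilon,r_{\max}+\varepsilon)$. Then at every $(x,r)\in\mathfrak C_{\Omega^\circ}$: (1) $\nabla^{\mathfrak C}_VW(x,r)=v(r)w'(r)\,\partial_r$; (2) $\nabla^{\mathfrak C}_VX(x,r)=\nabla^{\mathfrak C}_XV(x,r)=\frac{v(r)}{r}X(x)$; (3) $\nabla^{\mathfrak C}_XY(x,r)=\sum_{i=1}^dX^i(x)\,\partial_{x_i}Y(x)-r\langle X(x),Y(x)\rangle\,\partial_r$, where $\langle\cdot,\cdot\rangle$ is the Euclidean inner product.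
   Context: The cone metric on $\Omega^\circ\times(r_{\min}-\varepsilon,r_{\max}+\varepsilon)$ is $g_{(x,r)}=dr^2+r^2g_{\mathbb R^d}$, i.e. $\langle a+b\partial_r,a'+b'\partial_r\rangle_{(x,r)}=r^2\langle a,a'\rangle+bb'$ for $a,a'\in\mathbb R^d$, $b,b'\in\mathbb R$. The lift of a vector field on one factor of the product is the vector field on the product that is tangent to that factor and projects to the given field (so it does not depend on the other coordinate). *)

theory Defs
  imports "HOL-Analysis.Analysis"
begin

section \<open>Smooth maps on open sets\<close>

text \<open>Used only for open \<open>S\<close>. Since the domain is finite-dimensional, quantifying over the
  directions \<open>v\<close> amounts to requiring that all iterated partial derivatives are differentiable.\<close>

primrec times_differentiable_on ::
    "nat \<Rightarrow> ('a::euclidean_space \<Rightarrow> 'b::real_normed_vector) \<Rightarrow> 'a set \<Rightarrow> bool" where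
  "times_differentiable_on 0 f S \<longleftrightarrow> continuous_on S f"
| "times_differentiable_on (Suc n) f S \<longleftrightarrow>
     (\<forall>x\<in>S. f differentiable (at x)) \<and>
     (\<forall>v. times_differentiable_on n (\<lambda>x. frechet_derivative f (at x) v) S)"

definition smooth_on :: "'a set \<Rightarrow> ('a::euclidean_space \<Rightarrow> 'b::real_normed_vector) \<Rightarrow> bool" where
  "smooth_on S f \<longleftrightarrow> (\<forall>n. times_differentiable_on n f S)"


section \<open>Connections on open subsets of a Euclidean space\<close>

text \<open>A vector field on an open set \<open>U\<close> of \<open>'a\<close> is a function \<open>'a \<Rightarrow> 'a\<close>, of which only the values
  on \<open>U\<close> matter, the tangent spaces being identified with \<open>'a\<close>. It acts on functions by
  directional differentiation.\<close>

definition field_deriv ::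
    "('a \<Rightarrow> 'a) \<Rightarrow> ('a::euclidean_space \<Rightarrow> 'b::real_normed_vector) \<Rightarrow> 'a \<Rightarrow> 'b" where
  "field_deriv A f = (\<lambda>p. frechet_derivative f (at p) (A p))"

definition lie_bracket :: "('a \<Rightarrow> 'a) \<Rightarrow> ('a \<Rightarrow> 'a) \<Rightarrow> 'a::euclidean_space \<Rightarrow> 'a" where
  "lie_bracket A B = (\<lambda>p. field_deriv A B p - field_deriv B A p)"

text \<open>Values of the fields outside \<open>U\<close> are irrelevant without further axioms: a field vanishing on
  \<open>U\<close> equals \<open>f\<close> times itself for a function \<open>f\<close> that vanishes on \<open>U\<close> and is 1 elsewhere, so
  tensoriality and the Leibniz rule force its contribution on \<open>U\<close> to be zero.\<close>

definition affine_connection ::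
    "'a set \<Rightarrow> (('a \<Rightarrow> 'a) \<Rightarrow> ('a \<Rightarrow> 'a) \<Rightarrow> 'a::euclidean_space \<Rightarrow> 'a) \<Rightarrow> bool" where
  "affine_connection U nabla \<longleftrightarrow>
     (\<forall>A B. smooth_on U A \<longrightarrow> smooth_on U B \<longrightarrow> smooth_on U (nabla A B)) \<and>
     (\<forall>A A' B. smooth_on U A \<longrightarrow> smooth_on U A' \<longrightarrow> smooth_on U B \<longrightarrow>
        (\<forall>p\<in>U. nabla (\<lambda>q. A q + A' q) B p = nabla A B p + nabla A' B p)) \<and>
     (\<forall>(f::'a \<Rightarrow> real) A B. smooth_on U f \<longrightarrow> smooth_on U A \<longrightarrow> smooth_on U B \<longrightarrow>
        (\<forall>p\<in>U. nabla (\<lambda>q. f q *\<^sub>R A q) B p = f p *\<^sub>R nabla A B p)) \<and>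
     (\<forall>A B B'. smooth_on U A \<longrightarrow> smooth_on U B \<longrightarrow> smooth_on U B' \<longrightarrow>
        (\<forall>p\<in>U. nabla A (\<lambda>q. B q + B' q) p = nabla A B p + nabla A B' p)) \<and>
     (\<forall>(f::'a \<Rightarrow> real) A B. smooth_on U f \<longrightarrow> smooth_on U A \<longrightarrow> smooth_on U B \<longrightarrow>
        (\<forall>p\<in>U. nabla A (\<lambda>q. f q *\<^sub>R B q) p = field_deriv A f p *\<^sub>R B p + f p *\<^sub>R nabla A B p))"

text \<open>\<open>g p a b\<close> is the value at the point \<open>p\<close> of a Riemannian metric on the tangent vectors
  \<open>a\<close> and \<open>b\<close>.\<close>

definition levi_civita_connection ::
    "'a set \<Rightarrow> ('a \<Rightarrow> 'a \<Rightarrow> 'a \<Rightarrow> real) \<Rightarrow> (('a \<Rightarrow> 'a) \<Rightarrow> ('a \<Rightarrow> 'a) \<Rightarrow> 'a::euclidean_space \<Rightarrow> 'a) \<Rightarrow> bool"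
where
  "levi_civita_connection U g nabla \<longleftrightarrow>
     affine_connection U nabla \<and>
     (\<forall>A B. smooth_on U A \<longrightarrow> smooth_on U B \<longrightarrow>
        (\<forall>p\<in>U. nabla A B p - nabla B A p = lie_bracket A B p)) \<and>
     (\<forall>A B C. smooth_on U A \<longrightarrow> smooth_on U B \<longrightarrow> smooth_on U C \<longrightarrow>
        (\<forall>p\<in>U. field_deriv A (\<lambda>q. g q (B q) (C q)) p
               = g p (nabla A B p) (C p) + g p (B p) (nabla A C p)))"


section \<open>The cone\<close>

definition cone_metric :: "'a::euclidean_space \<times> real \<Rightarrow> 'a \<times> real \<Rightarrow> 'a \<times> real \<Rightarrow> real" where
  "cone_metric p a b = (snd p)\<^sup>2 * (fst a \<bullet> fst b) + snd a * snd b"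

definition lift_base :: "('a::euclidean_space \<Rightarrow> 'a) \<Rightarrow> 'a \<times> real \<Rightarrow> 'a \<times> real" where
  "lift_base X = (\<lambda>(x, r). (X x, 0))"

definition dr :: "'a::euclidean_space \<times> real" where
  "dr = (0, 1)"

definition lift_radial :: "(real \<Rightarrow> real) \<Rightarrow> 'a::euclidean_space \<times> real \<Rightarrow> 'a \<times> real" where
  "lift_radial v = (\<lambda>(x, r). v r *\<^sub>R dr)"

definition partial_deriv ::
    "'n::finite \<Rightarrow> (real ^ 'n \<Rightarrow> 'b::real_normed_vector) \<Rightarrow> real ^ 'n \<Rightarrow> 'b" where
  "partial_deriv i F x = vector_derivative (\<lambda>t. F (x + t *\<^sub>R axis i 1)) (at 0)"


section \<open>Existence of the Levi-Civita connection of the cone metric\<close>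

text \<open>The definition of \<open>levi_civita_connection\<close> is satisfiable for the cone metric, so that a statement
  about every Levi-Civita connection of the cone is not vacuous. (Uniqueness on \<open>U\<close> is the usual
  Koszul argument.)\<close>

lemma td_cong:
  assumes "open S" "\<And>x. x \<in> S \<Longrightarrow> f x = g x" "times_differentiable_on n f S"
  shows "times_differentiable_on n g S"
  using assms(2,3)
proof (induction n arbitrary: f g)
  case 0
  then show ?case by (simp cong: continuous_on_cong)
next
  case (Suc n)
  have D: "(g has_derivative frechet_derivative f (at x)) (at x)" if "x \<in> S" for x
    using Suc.prems that frechet_derivative_works has_derivative_transform_within_open[OF _ assms(1) that]
    by (metis times_differentiable_on.simps(2))
  have E: "frechet_derivative g (at x) = frechet_derivative f (at x)" if "x \<in> S" for x
    using D[OF that] frechet_derivative_at by metis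
  have "times_differentiable_on n (\<lambda>x. frechet_derivative g (at x) v) S" for v
    by (rule Suc.IH[of "\<lambda>x. frechet_derivative f (at x) v"]) (use Suc.prems E in auto)
  then show ?case using D by (auto simp: differentiable_def)
qed

lemma td_SucI:
  assumes "open S" "\<And>x. x \<in> S \<Longrightarrow> (f has_derivative f' x) (at x)"
    "\<And>v. times_differentiable_on n (\<lambda>x. f' x v) S"
  shows "times_differentiable_on (Suc n) f S"
proof -
  have E: "f' x = frechet_derivative f (at x)" if "x \<in> S" for x
    using assms(2)[OF that] frechet_derivative_at by metis
  have "times_differentiable_on n (\<lambda>x. frechet_derivative f (at x) v) S" for v
    by (rule td_cong[OF assms(1) _ assms(3)[of v]]) (simp add: E)
  then show ?thesis using assms(2) by (auto simp: differentiable_def)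
qed

lemma td_SucD:
  assumes "times_differentiable_on (Suc n) f S" "x \<in> S"
  shows "(f has_derivative frechet_derivative f (at x)) (at x)"
  using assms frechet_derivative_works by auto

lemma td_lower:
  assumes "times_differentiable_on (Suc n) f S"
  shows "times_differentiable_on n f S"
  using assms
proof (induction n arbitrary: f)
  case 0
  then show ?case
    by (auto intro!: continuous_at_imp_continuous_on differentiable_imp_continuous_within)
next
  case (Suc n)
  then show ?case by (metis times_differentiable_on.simps(2))
qed

lemma td_const: "times_differentiable_on n (\<lambda>x. c) S"
  by (induction n arbitrary: c) auto

lemma td_linear:
  assumes "open S" "bounded_linear h" "times_differentiable_on n f S"
  shows "times_differentiable_on n (\<lambda>x. h (f x)) S"
  using assms(3)
proof (induction n arbitrary: f)
  case 0
  then show ?case by (simp add: bounded_linear.continuous_on[OF assms(2)])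
next
  case (Suc n)
  show ?case
    by (rule td_SucI[OF assms(1) bounded_linear.has_derivative[OF assms(2) td_SucD[OF Suc.prems]]])
       (use Suc in auto)
qed

lemma td_bounded_linear:
  assumes "open S" "bounded_linear f"
  shows "times_differentiable_on n f S"
proof (cases n)
  case 0
  then show ?thesis using assms by (simp add: linear_continuous_on)
next
  case (Suc m)
  show ?thesis unfolding Suc
    by (rule td_SucI[OF assms(1) bounded_linear_imp_has_derivative[OF assms(2)] td_const])
qed

lemma td_add:
  assumes "open S" "times_differentiable_on n f S" "times_differentiable_on n g S"
  shows "times_differentiable_on n (\<lambda>x. f x + g x) S"
  using assms(2,3)
proof (induction n arbitrary: f g)
  case 0
  then show ?case by (simp add: continuous_on_add)
next
  case (Suc n)
  show ?case
    by (rule td_SucI[OF assms(1) has_derivative_add[OF td_SucD[OF Suc.prems(1)] td_SucD[OF Suc.prems(2)]]])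
       (use Suc in auto)
qed

lemma td_bilinear:
  assumes "open S" "bounded_bilinear h" "times_differentiable_on n f S" "times_differentiable_on n g S"
  shows "times_differentiable_on n (\<lambda>x. h (f x) (g x)) S"
  using assms(3,4)
proof (induction n arbitrary: f g)
  case 0
  then show ?case by (simp add: bounded_bilinear.continuous_on[OF assms(2)])
next
  case (Suc n)
  show ?case
    by (rule td_SucI[OF assms(1) bounded_bilinear.FDERIV[OF assms(2) td_SucD[OF Suc.prems(1)] td_SucD[OF Suc.prems(2)]]])
       (use Suc td_lower[OF Suc.prems(1)] td_lower[OF Suc.prems(2)] in \<open>auto intro!: td_add assms(1)\<close>)
qed

lemma td_sum:
  assumes "open S" "\<And>i. i \<in> I \<Longrightarrow> times_differentiable_on n (f i) S"
  shows "times_differentiable_on n (\<lambda>x. \<Sum>i\<in>I. f i x) S"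
  using assms(2)
proof (induction I rule: infinite_finite_induct)
  case (insert i I)
  then show ?case by (auto intro!: td_add assms(1))
qed (auto simp: td_const)

lemma td_inverse:
  fixes f :: "'a::euclidean_space \<Rightarrow> real"
  assumes "open S" "\<And>x. x \<in> S \<Longrightarrow> f x \<noteq> 0" "times_differentiable_on n f S"
  shows "times_differentiable_on n (\<lambda>x. inverse (f x)) S"
  using assms(3)
proof (induction n)
  case 0
  then show ?case using assms(2) by (simp add: continuous_on_inverse)
next
  case (Suc n)
  have "((\<lambda>x. inverse (f x)) has_derivative
      (\<lambda>h. - (inverse (f x) * frechet_derivative f (at x) h * inverse (f x)))) (at x)" if "x \<in> S" for x
    by (rule Deriv.has_derivative_inverse[OF assms(2)[OF that] td_SucD[OF Suc.prems that]])
  moreover have "times_differentiable_on n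
       (\<lambda>x. - (inverse (f x) * frechet_derivative f (at x) h * inverse (f x))) S" for h
    using Suc td_lower[OF Suc.prems]
    by (intro td_linear[OF assms(1) bounded_linear_minus[OF bounded_linear_ident]]
        td_bilinear[OF assms(1) bounded_bilinear_mult]) auto
  ultimately show ?case by (rule td_SucI[OF assms(1)])
qed

lemma smooth_diff: "smooth_on S f \<Longrightarrow> x \<in> S \<Longrightarrow> (f has_derivative frechet_derivative f (at x)) (at x)"
  unfolding smooth_on_def using td_SucD by blast

lemma td_field:
  assumes "open S" "smooth_on S A" "smooth_on S f"
  shows "times_differentiable_on n (field_deriv A f) S"
proof -
  have "times_differentiable_on n (\<lambda>p. \<Sum>b\<in>Basis. (A p \<bullet> b) *\<^sub>R frechet_derivative f (at p) b) S"
  proof (intro td_sum[OF assms(1)] td_bilinear[OF assms(1) bounded_bilinear_scaleR]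
      td_bilinear[OF assms(1) bounded_bilinear_inner] td_const)
    show "times_differentiable_on n A S" using assms(2) by (simp add: smooth_on_def)
    have "times_differentiable_on (Suc n) f S" using assms(3) unfolding smooth_on_def by blast
    then show "times_differentiable_on n (\<lambda>p. frechet_derivative f (at p) b) S" for b by simp
  qed
  then show ?thesis
  proof (rule td_cong[OF assms(1), rotated])
    fix p assume "p \<in> S"
    then have "linear (frechet_derivative f (at p))"
      using smooth_diff[OF assms(3)] has_derivative_linear by blast
    then have "frechet_derivative f (at p) (\<Sum>b\<in>Basis. (A p \<bullet> b) *\<^sub>R b)
        = (\<Sum>b\<in>Basis. (A p \<bullet> b) *\<^sub>R frechet_derivative f (at p) b)"
      by (simp only: linear_sum linear_scale)
    then show "(\<Sum>b\<in>Basis. (A p \<bullet> b) *\<^sub>R frechet_derivative f (at p) b) = field_deriv A f p"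
      unfolding field_deriv_def by (simp only: euclidean_representation)
  qed
qed

definition cone_christoffel :: "'a::euclidean_space \<times> real \<Rightarrow> 'a \<times> real \<Rightarrow> 'a \<times> real \<Rightarrow> 'a \<times> real" where
  "cone_christoffel p a b = (inverse (snd p) *\<^sub>R (snd a *\<^sub>R fst b + snd b *\<^sub>R fst a), - (snd p * (fst a \<bullet> fst b)))"

lemma exists_levi_civita_connection_cone:
  fixes S :: "('a::euclidean_space \<times> real) set"
  assumes S: "open S" "\<And>p. p \<in> S \<Longrightarrow> snd p > 0"
  shows "\<exists>nabla. levi_civita_connection S cone_metric nabla"
proof
  define N where "N = (\<lambda>A B (p::'a\<times>real). field_deriv A B p + cone_christoffel p (A p) (B p))"
  have chris_eq: "cone_christoffel p a b = inverse (snd p) *\<^sub>R snd a *\<^sub>R (fst b, 0) + inverse (snd p) *\<^sub>R snd b *\<^sub>R (fst a,0)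
     + (snd p * (fst a \<bullet> fst b)) *\<^sub>R (0,-1)" for p a and b :: "'a \<times> real"
    by (simp add: cone_christoffel_def algebra_simps)
  have bl: "bounded_linear (\<lambda>a::'a\<times>real. (fst a, 0::real))"
    by (intro bounded_linear_intros)
  have sm: "smooth_on S (N A B)" if "smooth_on S A" "smooth_on S B" for A B
    unfolding smooth_on_def
  proof
    fix n
    note bs = td_bilinear[OF S(1) bounded_bilinear_scaleR]
    have A: "times_differentiable_on n A S" and B: "times_differentiable_on n B S"
      using that by (simp_all add: smooth_on_def)
    have r: "times_differentiable_on n (\<lambda>p. snd p) S"
      by (rule td_bounded_linear[OF S(1) bounded_linear_snd])
    have ir: "times_differentiable_on n (\<lambda>p. inverse (snd p)) S"
      by (rule td_inverse[OF S(1) _ r]) (use S(2) in force)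
    note l = td_linear[OF S(1) bounded_linear_fst] td_linear[OF S(1) bounded_linear_snd] td_linear[OF S(1) bl]
    have 1: "times_differentiable_on n (\<lambda>p. inverse (snd p) *\<^sub>R snd (A p) *\<^sub>R (fst (B p), 0::real)) S"
      by (rule bs[OF ir bs[OF l(2)[OF A] l(3)[OF B]]])
    have 2: "times_differentiable_on n (\<lambda>p. inverse (snd p) *\<^sub>R snd (B p) *\<^sub>R (fst (A p), 0::real)) S"
      by (rule bs[OF ir bs[OF l(2)[OF B] l(3)[OF A]]])
    have 3: "times_differentiable_on n (\<lambda>p. (snd p * (fst (A p) \<bullet> fst (B p))) *\<^sub>R (0::'a, -1::real)) S"
      by (rule bs[OF td_bilinear[OF S(1) bounded_bilinear_mult r
             td_bilinear[OF S(1) bounded_bilinear_inner l(1)[OF A] l(1)[OF B]]] td_const])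
    show "times_differentiable_on n (N A B) S"
      unfolding N_def chris_eq
      by (rule td_add[OF S(1) td_field[OF S(1) that] td_add[OF S(1) td_add[OF S(1) 1 2] 3]])
  qed
  have fd_add: "field_deriv A (\<lambda>q. B q + B' q) p = field_deriv A B p + field_deriv A B' p"
    if "smooth_on S B" "smooth_on S B'" "p \<in> S" for A and B B' :: "_ \<Rightarrow> 'a \<times> real" and p
    unfolding field_deriv_def
    by (simp only: frechet_derivative_at[OF has_derivative_add[OF smooth_diff[OF that(1,3)] smooth_diff[OF that(2,3)]], symmetric])
  have fd_scale: "field_deriv A (\<lambda>q. f q *\<^sub>R B q) p = field_deriv A f p *\<^sub>R B p + f p *\<^sub>R field_deriv A B p"
    if "smooth_on S f" "smooth_on S B" "p \<in> S" for A f and B :: "_ \<Rightarrow> 'a \<times> real" and p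
    unfolding field_deriv_def
    by (simp only: frechet_derivative_at[OF has_derivative_scaleR[OF smooth_diff[OF that(1,3)] smooth_diff[OF that(2,3)]], symmetric] add.commute)
  have lin: "linear (frechet_derivative B (at p))" if "smooth_on S B" "p \<in> S" for B :: "_ \<Rightarrow> 'a \<times> real" and p
      using smooth_diff[OF that] has_derivative_linear by blast
  have "affine_connection S N"
    unfolding affine_connection_def
    apply (intro conjI allI impI ballI)
    subgoal by (rule sm)
    subgoal by (simp add: N_def field_deriv_def lin linear_add cone_christoffel_def algebra_simps)
    subgoal by (simp add: N_def field_deriv_def lin linear_scale cone_christoffel_def algebra_simps)
    subgoal by (simp add: N_def fd_add cone_christoffel_def algebra_simps)
    subgoal by (simp add: N_def fd_scale cone_christoffel_def algebra_simps)
    done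
  moreover have "N A B p - N B A p = lie_bracket A B p" for A B p
    by (simp add: N_def lie_bracket_def cone_christoffel_def inner_commute algebra_simps)
  moreover have "field_deriv A (\<lambda>q. cone_metric q (B q) (C q)) p
               = cone_metric p (N A B p) (C p) + cone_metric p (B p) (N A C p)"
    if "smooth_on S B" "smooth_on S C" "p \<in> S" for A B C p
  proof -
    note dB = smooth_diff[OF that(1,3)] and dC = smooth_diff[OF that(2,3)]
    have "((\<lambda>q. cone_metric q (B q) (C q)) has_derivative
      (\<lambda>h. 2 * snd p * snd h * (fst (B p) \<bullet> fst (C p))
         + (snd p)\<^sup>2 * (fst (frechet_derivative B (at p) h) \<bullet> fst (C p) + fst (B p) \<bullet> fst (frechet_derivative C (at p) h))
         + snd (frechet_derivative B (at p) h) * snd (C p) + snd (B p) * snd (frechet_derivative C (at p) h))) (at p)"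
      unfolding cone_metric_def power2_eq_square
      by (rule has_derivative_eq_rhs, (rule derivative_intros dB dC)+) (auto simp: algebra_simps)
    from frechet_derivative_at[OF this, symmetric] S(2)[OF that(3)]
    show ?thesis
      by (simp add: field_deriv_def cone_metric_def N_def cone_christoffel_def power2_eq_square inner_commute field_simps)
         (simp add: algebra_simps inner_commute)?
  qed
  ultimately show "levi_civita_connection S cone_metric N"
    unfolding levi_civita_connection_def by blast
qed

end

theory Submission
  imports Defs
begin

text \<open>Let \<open>N\<^sub>A B\<close> be the directional derivative of \<open>B\<close> along \<open>A\<close> plus the Christoffel term of the
  cone metric. It is torsion free and compatible with the metric, so its difference \<open>T\<close> to a
  Levi-Civita connection is symmetric, and the trilinear form \<open>\<langle>T(A, B), C\<rangle>\<close> is symmetric in its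
  first two and antisymmetric in its last two arguments. Such a form vanishes, hence every
  Levi-Civita connection is given by \<open>N\<close>, and the three formulas result from evaluating \<open>N\<close>
  on lifts.\<close>

text \<open>Alternating the two symmetries gives \<open>t a b c = t b a c = - t b c a = - t c b a =
  t c a b = t a c b = - t a b c\<close>. In the application the arguments are vector fields rather
  than tangent vectors, and \<open>P\<close> is smoothness, so the argument works without first
  showing that the form is tensorial.\<close>

lemma symmetric_antisymmetric_trilinear_zero:
  fixes t :: "'a \<Rightarrow> 'a \<Rightarrow> 'a \<Rightarrow> real"
  assumes sym: "\<And>a b c. P a \<Longrightarrow> P b \<Longrightarrow> P c \<Longrightarrow> t a b c = t b a c"
    and anti: "\<And>a b c. P a \<Longrightarrow> P b \<Longrightarrow> P c \<Longrightarrow> t a b c = - t a c b"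
    and "P a" "P b" "P c"
  shows "t a b c = 0"
  using sym[OF \<open>P a\<close> \<open>P b\<close> \<open>P c\<close>] sym[OF \<open>P b\<close> \<open>P c\<close> \<open>P a\<close>] sym[OF \<open>P c\<close> \<open>P a\<close> \<open>P b\<close>]
    anti[OF \<open>P a\<close> \<open>P b\<close> \<open>P c\<close>] anti[OF \<open>P b\<close> \<open>P c\<close> \<open>P a\<close>] anti[OF \<open>P c\<close> \<open>P a\<close> \<open>P b\<close>]
  by linarith

section \<open>The cone metric and uniqueness of its Levi-Civita connection\<close>

lemma cone_metric_commute: "cone_metric p a b = cone_metric p b a"
  by (simp add: cone_metric_def inner_commute)

lemma cone_metric_diff_left: "cone_metric p (a - a') b = cone_metric p a b - cone_metric p a' b"
  by (simp add: cone_metric_def algebra_simps)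

text \<open>Away from the apex the metric is a sum of squares with positive weights. This
  definiteness later turns orthogonality to all vectors into vanishing.\<close>

lemma cone_metric_self_eq_0_iff:
  assumes "snd p \<noteq> 0"
  shows "cone_metric p a a = 0 \<longleftrightarrow> a = 0"
proof -
  have "cone_metric p a a = (snd p)\<^sup>2 * (norm (fst a))\<^sup>2 + (snd a)\<^sup>2"
    by (simp add: cone_metric_def power2_norm_eq_inner) (simp add: power2_eq_square)
  then show ?thesis
    using assms by (simp add: add_nonneg_eq_0_iff prod_eq_iff)
qed

text \<open>Metric compatibility of the explicit connection. Differentiating the factor
  \<open>r^2\<close> yields an extra \<open>2 * r\<close> times the radial part of \<open>A\<close>
  times the inner product of the base parts of \<open>B\<close> and \<open>C\<close>. The two
  Christoffel terms contribute half of it each, and their remaining parts cancel.\<close>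

lemma field_deriv_cone_metric:
  assumes B: "smooth_on S B" and C: "smooth_on S C" and p: "p \<in> S" and "snd p \<noteq> 0"
  shows "field_deriv A (\<lambda>q. cone_metric q (B q) (C q)) p
    = cone_metric p (field_deriv A B p + cone_christoffel p (A p) (B p)) (C p)
      + cone_metric p (B p) (field_deriv A C p + cone_christoffel p (A p) (C p))"
proof -
  note dB = smooth_diff[OF B p] and dC = smooth_diff[OF C p]
  have "((\<lambda>q. cone_metric q (B q) (C q)) has_derivative
      (\<lambda>h. 2 * snd p * snd h * (fst (B p) \<bullet> fst (C p))
         + cone_metric p (frechet_derivative B (at p) h) (C p)
         + cone_metric p (B p) (frechet_derivative C (at p) h))) (at p)"
    unfolding cone_metric_def power2_eq_square
    by (rule has_derivative_eq_rhs, (rule derivative_intros dB dC)+) (auto simp: algebra_simps)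
  note eq = frechet_derivative_at[OF this, symmetric]
  show ?thesis
    unfolding field_deriv_def eq using \<open>snd p \<noteq> 0\<close>
    by (simp add: cone_metric_def cone_christoffel_def power2_eq_square inner_add_left inner_add_right)
       (simp add: field_simps inner_commute)
qed

lemma levi_civita_connection_cone_eq:
  assumes nabla: "levi_civita_connection S cone_metric nabla"
    and p: "p \<in> S" "snd p \<noteq> 0"
    and A: "smooth_on S A" and B: "smooth_on S B"
  shows "nabla A B p = field_deriv A B p + cone_christoffel p (A p) (B p)"
proof -
  define N where "N A B = field_deriv A B p + cone_christoffel p (A p) (B p)" for A B
  define T where "T A B = nabla A B p - N A B" for A B
  have N_torsion: "N A B - N B A = lie_bracket A B p" for A B
    by (simp add: N_def lie_bracket_def cone_christoffel_def inner_commute algebra_simps)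
  have torsion: "nabla A B p - nabla B A p = lie_bracket A B p"
    and compat: "field_deriv A (\<lambda>q. cone_metric q (B q) (C q)) p
      = cone_metric p (nabla A B p) (C p) + cone_metric p (B p) (nabla A C p)"
    if "smooth_on S A" "smooth_on S B" "smooth_on S C" for A B C
    using nabla that p(1) unfolding levi_civita_connection_def by blast+
  have T_sym: "T A B = T B A" if "smooth_on S A" "smooth_on S B" for A B
    using torsion[OF that that(2)] N_torsion[of A B] unfolding T_def by (simp add: algebra_simps)
  \<comment> \<open>Both connections obey the product rule for the same function, so subtracting the
    two rules leaves a vanishing sum of two \<open>T\<close> terms.\<close>
  have T_anti: "cone_metric p (T A B) (C p) = - cone_metric p (T A C) (B p)"
    if "smooth_on S A" "smooth_on S B" "smooth_on S C" for A B C
    using compat[OF that] field_deriv_cone_metric[OF that(2,3) p, of A]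
    unfolding T_def N_def cone_metric_diff_left
    by (simp add: cone_metric_commute[of p "B p"])
  have "cone_metric p (T A B) (C p) = 0" if "smooth_on S C" for C
    by (rule symmetric_antisymmetric_trilinear_zero[where P = "smooth_on S"
          and t = "\<lambda>A B C. cone_metric p (T A B) (C p)", OF _ T_anti A B that])
       (simp_all add: T_sym)
  \<comment> \<open>The vector \<open>T A B\<close> at \<open>p\<close> is extended to a constant
    field, which is an admissible choice of \<open>C\<close>; definiteness then applies.\<close>
  moreover have "smooth_on S (\<lambda>_. T A B)"
    by (simp add: smooth_on_def td_const)
  ultimately have "cone_metric p (T A B) (T A B) = 0"
    by blast
  then have "T A B = 0"
    by (simp add: cone_metric_self_eq_0_iff p(2))
  then show ?thesis
    by (simp add: T_def N_def)
qed

section \<open>Smoothness of lifts, seen as compositions with linear maps\<close>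

lemma smooth_on_compose_bounded_linear:
  assumes "open T" "bounded_linear h" "h ` T \<subseteq> S" "smooth_on S f"
  shows "smooth_on T (\<lambda>x. f (h x))"
proof -
  have "times_differentiable_on n (\<lambda>x. f (h x)) T" if "times_differentiable_on n f S" for n
    using that
  proof (induction n arbitrary: f)
    case 0
    then show ?case
      using assms(3) by (auto intro: continuous_on_compose2[of S f] linear_continuous_on[OF assms(2)])
  next
    case (Suc n)
    show ?case
    proof (rule td_SucI[OF assms(1)])
      show "((\<lambda>x. f (h x)) has_derivative (\<lambda>k. frechet_derivative f (at (h x)) (h k))) (at x)"
        if "x \<in> T" for x
        using that assms(3) td_SucD[OF Suc.prems, of "h x"]
        by (intro has_derivative_compose[OF bounded_linear_imp_has_derivative[OF assms(2)]]) auto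
      \<comment> \<open>As \<open>h\<close> is linear, the direction \<open>h k\<close> is
        independent of \<open>x\<close>. The derivative is therefore again a fixed function composed
        with \<open>h\<close>, and the induction hypothesis applies to that function.\<close>
      show "times_differentiable_on n (\<lambda>x. frechet_derivative f (at (h x)) (h k)) T" for k
        using Suc.prems by (intro Suc.IH) simp
    qed
  qed
  then show ?thesis
    using assms(4) by (simp add: smooth_on_def)
qed

lemma smooth_on_bounded_linear_image:
  assumes "open S" "bounded_linear h" "smooth_on S f"
  shows "smooth_on S (\<lambda>x. h (f x))"
  using assms by (simp add: smooth_on_def td_linear)

lemma lift_base_alt: "lift_base X = (\<lambda>p. (X (fst p), 0))"
  by (auto simp: lift_base_def)

lemma lift_radial_alt: "lift_radial v = (\<lambda>p. (0, v (snd p)))"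
  by (auto simp: lift_radial_def dr_def)

lemma smooth_on_lift_base:
  assumes "open S" "open I" "smooth_on S X"
  shows "smooth_on (S \<times> I) (lift_base X)"
  unfolding lift_base_alt
proof (rule smooth_on_bounded_linear_image[where h = "\<lambda>a. (a, 0)"])
  show "bounded_linear (\<lambda>a. (a, 0::real))"
    by (intro bounded_linear_intros)
  show "smooth_on (S \<times> I) (\<lambda>p. X (fst p))"
    by (rule smooth_on_compose_bounded_linear[OF _ bounded_linear_fst _ assms(3)])
       (auto intro: open_Times assms)
qed (intro open_Times assms)

lemma smooth_on_lift_radial:
  fixes S :: "'a::euclidean_space set"
  assumes "open S" "open I" "smooth_on I v"
  shows "smooth_on (S \<times> I) (lift_radial v)"
  unfolding lift_radial_alt
proof (rule smooth_on_bounded_linear_image[where h = "\<lambda>b. (0, b)"])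
  show "bounded_linear (\<lambda>b. (0::'a, b::real))"
    by (intro bounded_linear_intros)
  show "smooth_on (S \<times> I) (\<lambda>p. v (snd p))"
    by (rule smooth_on_compose_bounded_linear[OF _ bounded_linear_snd _ assms(3)])
       (auto intro: open_Times assms)
qed (intro open_Times assms)

section \<open>Directional derivatives of lifts\<close>

lemma field_deriv_lift_base:
  assumes "smooth_on S Y" "x \<in> S"
  shows "field_deriv A (lift_base Y) (x, r) = (frechet_derivative Y (at x) (fst (A (x, r))), 0)"
proof -
  \<comment> \<open>The point is written as \<open>fst (x, r)\<close> to match the chain rule for
    the projection.\<close>
  have Y: "(Y has_derivative frechet_derivative Y (at x)) (at (fst (x, r)))"
    using smooth_diff[OF assms] by simp
  have "(lift_base Y has_derivative (\<lambda>h. (frechet_derivative Y (at x) (fst h), 0))) (at (x, r))"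
    unfolding lift_base_alt
    by (intro has_derivative_Pair has_derivative_const
        has_derivative_compose[OF bounded_linear_imp_has_derivative[OF bounded_linear_fst] Y])
  from frechet_derivative_at[OF this, symmetric] show ?thesis
    by (simp add: field_deriv_def)
qed

lemma field_deriv_lift_radial:
  assumes "smooth_on I w" "r \<in> I"
  shows "field_deriv A (lift_radial w) (x, r) = (deriv w r * snd (A (x, r))) *\<^sub>R dr"
proof -
  have "w differentiable (at r)"
    using smooth_diff[OF assms] by (auto simp: differentiable_def)
  then have "(w has_derivative (*) (deriv w r)) (at (snd (x, r)))"
    by (simp add: DERIV_deriv_iff_real_differentiable flip: has_field_derivative_def)
  then have "(lift_radial w has_derivative (\<lambda>h. (0, deriv w r * snd h))) (at (x, r))"
    unfolding lift_radial_alt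
    by (intro has_derivative_Pair has_derivative_const
        has_derivative_compose[OF bounded_linear_imp_has_derivative[OF bounded_linear_snd]])
  from frechet_derivative_at[OF this, symmetric] show ?thesis
    by (simp add: field_deriv_def dr_def)
qed

section \<open>Partial derivatives as coordinates of the total derivative\<close>

lemma partial_deriv_eq_frechet_derivative:
  assumes "F differentiable (at x)"
  shows "partial_deriv i F x = frechet_derivative F (at x) (axis i 1)"
proof -
  \<comment> \<open>The base point is the value of the line \<open>x + t *\<^sub>R axis i 1\<close>
    at \<open>t = 0\<close>, as the chain rule expects.\<close>
  have "(F has_derivative frechet_derivative F (at x)) (at (x + 0 *\<^sub>R axis i 1))"
    using assms by (simp add: frechet_derivative_works)
  moreover have "((\<lambda>t. x + t *\<^sub>R axis i 1) has_derivative (\<lambda>t. t *\<^sub>R axis i 1)) (at 0)"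
    by (auto intro!: derivative_eq_intros)
  ultimately have "((\<lambda>t. F (x + t *\<^sub>R axis i 1)) has_derivative
      (\<lambda>t. frechet_derivative F (at x) (t *\<^sub>R axis i 1))) (at 0)"
    using has_derivative_compose by blast
  then show ?thesis
    unfolding partial_deriv_def using assms
    by (intro vector_derivative_at)
       (simp add: has_vector_derivative_def linear_scale[OF linear_frechet_derivative])
qed

lemma frechet_derivative_eq_sum_partial_deriv:
  fixes F :: "real ^ 'n \<Rightarrow> 'b::real_normed_vector"
  assumes "F differentiable (at x)"
  shows "frechet_derivative F (at x) h = (\<Sum>i\<in>UNIV. h $ i *\<^sub>R partial_deriv i F x)"
proof -
  note lin = linear_frechet_derivative[OF assms]
  have "frechet_derivative F (at x) (\<Sum>i\<in>UNIV. h $ i *\<^sub>R axis i 1)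
      = (\<Sum>i\<in>UNIV. h $ i *\<^sub>R frechet_derivative F (at x) (axis i 1))"
    by (simp only: linear_sum[OF lin] linear_scale[OF lin])
  moreover have "(\<Sum>i\<in>UNIV. h $ i *\<^sub>R axis i 1) = h"
    using basis_expansion[of h] by (simp add: scalar_mult_eq_scaleR)
  ultimately show ?thesis
    by (simp add: partial_deriv_eq_frechet_derivative[OF assms])
qed

theorem corollaryB4:
  fixes \<Omega> :: "(real ^ 'd) set"
    and rmin rmax \<epsilon> :: real
    and X Y :: "real ^ 'd \<Rightarrow> real ^ 'd"
    and v w :: "real \<Rightarrow> real"
    and nabla :: "((real ^ 'd) \<times> real \<Rightarrow> (real ^ 'd) \<times> real)
                  \<Rightarrow> ((real ^ 'd) \<times> real \<Rightarrow> (real ^ 'd) \<times> real)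
                  \<Rightarrow> (real ^ 'd) \<times> real \<Rightarrow> (real ^ 'd) \<times> real"
  assumes "interior \<Omega> \<noteq> {}"
    and "0 < rmin" and "rmin < rmax"
    and "0 < \<epsilon>" and "0 < rmin - \<epsilon>"
    and "levi_civita_connection (interior \<Omega> \<times> {rmin - \<epsilon><..<rmax + \<epsilon>}) cone_metric nabla"
    and "smooth_on (interior \<Omega>) X" and "smooth_on (interior \<Omega>) Y"
    and "smooth_on {rmin - \<epsilon><..<rmax + \<epsilon>} v" and "smooth_on {rmin - \<epsilon><..<rmax + \<epsilon>} w"
  shows "\<forall>x\<in>interior \<Omega>. \<forall>r\<in>{rmin - \<epsilon><..<rmax + \<epsilon>}.
      nabla (lift_radial v) (lift_radial w) (x, r) = (v r * deriv w r) *\<^sub>R dr \<and>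
      nabla (lift_radial v) (lift_base X) (x, r) = (v r / r) *\<^sub>R lift_base X (x, r) \<and>
      nabla (lift_base X) (lift_radial v) (x, r) = (v r / r) *\<^sub>R lift_base X (x, r) \<and>
      nabla (lift_base X) (lift_base Y) (x, r)
        = ((\<Sum>i\<in>UNIV. X x $ i *\<^sub>R partial_deriv i Y x), 0) - (r * (X x \<bullet> Y x)) *\<^sub>R dr"
proof (intro ballI conjI)
  fix x r
  assume x: "x \<in> interior \<Omega>" and r: "r \<in> {rmin - \<epsilon><..<rmax + \<epsilon>}"
  \<comment> \<open>Positivity of \<open>rmin - \<epsilon>\<close> keeps the cone away from the
    apex, where the metric degenerates.\<close>
  have "(x, r) \<in> interior \<Omega> \<times> {rmin - \<epsilon><..<rmax + \<epsilon>}"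
    and r0: "r \<noteq> 0"
    using x r \<open>0 < rmin - \<epsilon>\<close> by auto
  note nabla = levi_civita_connection_cone_eq[OF assms(6) this(1), simplified, OF r0]
  note base = smooth_on_lift_base[OF open_interior open_greaterThanLessThan]
  note radial = smooth_on_lift_radial[OF open_interior open_greaterThanLessThan]
  note X = base[OF assms(7)] and Y = base[OF assms(8)]
    and V = radial[OF assms(9)] and W = radial[OF assms(10)]
  note lifts = lift_base_alt lift_radial_alt cone_christoffel_def dr_def
  \<comment> \<open>Radial fields have no base part, so the Christoffel term vanishes.\<close>
  show "nabla (lift_radial v) (lift_radial w) (x, r) = (v r * deriv w r) *\<^sub>R dr"
    unfolding nabla[OF V W] field_deriv_lift_radial[OF assms(10) r]
    by (simp add: lifts)
  \<comment> \<open>A radial field differentiates \<open>X\<close> in the zero direction. By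
    linearity only the Christoffel term is left.\<close>
  have lin: "linear (frechet_derivative X (at x))"
    using smooth_diff[OF assms(7) x] has_derivative_linear by blast
  show "nabla (lift_radial v) (lift_base X) (x, r) = (v r / r) *\<^sub>R lift_base X (x, r)"
    unfolding nabla[OF V X] field_deriv_lift_base[OF assms(7) x]
    by (simp add: lifts linear_0[OF lin] divide_inverse_commute)
  \<comment> \<open>Here the derivative vanishes because \<open>lift_base X\<close> has no radial
    part; the Christoffel term is the same as before by symmetry.\<close>
  show "nabla (lift_base X) (lift_radial v) (x, r) = (v r / r) *\<^sub>R lift_base X (x, r)"
    unfolding nabla[OF X V] field_deriv_lift_radial[OF assms(9) r]
    by (simp add: lifts divide_inverse_commute)
  \<comment> \<open>For two base fields the Christoffel term is purely radial and the derivative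
    purely tangential to the base, which gives the two summands.\<close>
  have "Y differentiable (at x)"
    using smooth_diff[OF assms(8) x] by (auto simp: differentiable_def)
  then show "nabla (lift_base X) (lift_base Y) (x, r)
      = ((\<Sum>i\<in>UNIV. X x $ i *\<^sub>R partial_deriv i Y x), 0) - (r * (X x \<bullet> Y x)) *\<^sub>R dr"
    unfolding nabla[OF X Y] field_deriv_lift_base[OF assms(8) x]
    by (simp add: lifts frechet_derivative_eq_sum_partial_deriv)
qed

end
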